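(* Let $J$ be a finite set of jobs, job $j$ having processing time $p_j>0$ and weight $w_j>0$. The procedure $\mathrm{FastSchedule}$ described in the context, called as $\mathrm{FastSchedule}(J,0)$, returns an ordering of $J$ that minimizes $\sum_{j\in J}-w_j/C_j$ (equivalently maximizes $\sum_{j\in J}w_j/C_j$) over all orderings of $J$, together with this optimal value.
   Context: Jobs and schedules. $J$ is a finite set of jobs; job $j$ has processing time $p_j>0$ and weight $w_j>0$; $T=\sum_{j\in J}p_j$. A schedule is an ordering of $J$ processed consecutively without idle time from time $0$; job $j$ has start time $t_j$ and completion time $C_j=t_j+p_j$. Auxiliary quantities. For a job $j$ and $t\ge 0$ let $\varphi_j(t)=\frac{w_j}{p_j(p_j+t)}$. For two jobs $i,j$ with $w_ip_j\neq w_jp_i$ let $t^*_{ij}=\frac{w_jp_i^2-w_ip_j^2}{w_ip_j-w_jp_i}$ (symmetric in $i,j$; the unique real $t$ with $\varphi_i(t)=\varphi_j(t)$). Banned sets. For $i\in J$, let $B_i$ be the union, over all $j\in J\setminus\{i\}$ with $\varphi_i(0)>\varphi_j(0)$, $w_ip_j\ne w_jp_i$ and $t^*_{ij}\in(0,T)$, of the intervals $[t^*_{ij},t^*_{ij}+p_j)$. Subproblem data. For $J'\subseteq J$ and $t_o\ge0$ let $t_e=t_o+\sum_{j\in J'}p_j$. Let $\alpha\in J'$ maximize $\varphi_i(t_o)$ over $i\in J'$, ties broken in favour of maximum $\varphi_i(t_e)$. For $j\in J'\setminus\{\alpha\}$ with $t^*_{\alpha j}$ defined put $c_{\alpha j}=t^*_{\alpha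 j}+p_j$. Let $C=\{c_{\alpha j}: j\in J'\setminus\{\alpha\},\ t^*_{\alpha j}\text{ defined},\ c_{\alpha j}\in(t_o,t_e)\}\cup\{t_o,t_e\}$ and list its distinct elements as $t_o=c_1<c_2<\dots<c_m=t_e$. Define $M(\alpha)=1$; for $j\ne\alpha$, $M(j)=r$ if $t^*_{\alpha j}$ is defined, $t^*_{\alpha j}\in(t_o,t_e)$ and $c_{\alpha j}=c_r$ for some $r\le m$; and $M(j)=|J'|+1$ otherwise. Procedure $\mathrm{FastSchedule}(J',t)$: if $J'=\emptyset$ return value $0$ and the empty sequence; if $J'=\{j\}$ return value $w_j/(p_j+t)$ and the sequence $(j)$. Otherwise compute, with $t_o=t$, the job $\alpha$, the points $c_1<\dots<c_m$ and $M$. For each $q=1,\dots,m-1$ let $J_l^q=\{j\in J'\setminus\{\alpha\}:M(j)\le q\}$, $J_r^q=\{j\in J':M(j)>q\}$ and $s_q=t+\sum_{j\in J_l^q}p_j$. If $c_q\le s_q<c_{q+1}$ and $s_q\notin B_\alpha$, recursively compute $(v_l,\sigma_l)=\mathrm{FastSchedule}(J_l^q,t)$ and $(v_r,\sigma_r)=\mathrm{FastSchedule}(J_r^q,s_q+p_\alpha)$ and form the candidate of value $v_l+v_r+w_\alpha/(s_q+p_\alpha)$ with sequence $\sigma_l,\alpha,\sigma_r$. Return the candidate of maximum value. *)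

theory Defs
  imports Complex_Main
begin

definition is_schedule :: "'a set \<Rightarrow> 'a list \<Rightarrow> bool" where
  "is_schedule J \<sigma> \<longleftrightarrow> distinct \<sigma> \<and> set \<sigma> = J"

definition compl_time :: "('a \<Rightarrow> real) \<Rightarrow> 'a list \<Rightarrow> nat \<Rightarrow> real" where
  "compl_time p \<sigma> k = sum_list (map p (take (Suc k) \<sigma>))"

definition sched_val :: "('a \<Rightarrow> real) \<Rightarrow> ('a \<Rightarrow> real) \<Rightarrow> 'a list \<Rightarrow> real" where
  "sched_val p w \<sigma> = (\<Sum>k<length \<sigma>. w (\<sigma> ! k) / compl_time p \<sigma> k)"

definition phi :: "('a \<Rightarrow> real) \<Rightarrow> ('a \<Rightarrow> real) \<Rightarrow> 'a \<Rightarrow> real \<Rightarrow> real" where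
  "phi p w j t = w j / (p j * (p j + t))"

definition tstar_defined :: "('a \<Rightarrow> real) \<Rightarrow> ('a \<Rightarrow> real) \<Rightarrow> 'a \<Rightarrow> 'a \<Rightarrow> bool" where
  "tstar_defined p w i j \<longleftrightarrow> w i * p j \<noteq> w j * p i"

definition tstar :: "('a \<Rightarrow> real) \<Rightarrow> ('a \<Rightarrow> real) \<Rightarrow> 'a \<Rightarrow> 'a \<Rightarrow> real" where
  "tstar p w i j = (w j * (p i)^2 - w i * (p j)^2) / (w i * p j - w j * p i)"

definition banned :: "'a set \<Rightarrow> ('a \<Rightarrow> real) \<Rightarrow> ('a \<Rightarrow> real) \<Rightarrow> 'a \<Rightarrow> real set" where
  "banned J p w i = (\<Union>j \<in> {j \<in> J - {i}. phi p w i 0 > phi p w j 0 \<and> tstar_defined p w i j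
        \<and> tstar p w i j \<in> {0<..<sum p J}}.
        {tstar p w i j ..< tstar p w i j + p j})"

definition t_end :: "('a \<Rightarrow> real) \<Rightarrow> 'a set \<Rightarrow> real \<Rightarrow> real" where
  "t_end p J' to = to + sum p J'"

definition is_alpha :: "('a \<Rightarrow> real) \<Rightarrow> ('a \<Rightarrow> real) \<Rightarrow> 'a set \<Rightarrow> real \<Rightarrow> 'a \<Rightarrow> bool" where
  "is_alpha p w J' to a \<longleftrightarrow> a \<in> J' \<and> (\<forall>i\<in>J'. phi p w i to \<le> phi p w a to) \<and>
     (\<forall>i\<in>J'. phi p w i to = phi p w a to \<longrightarrow> phi p w i (t_end p J' to) \<le> phi p w a (t_end p J' to))"

definition c_aj :: "('a \<Rightarrow> real) \<Rightarrow> ('a \<Rightarrow> real) \<Rightarrow> 'a \<Rightarrow> 'a \<Rightarrow> real" where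
  "c_aj p w a j = tstar p w a j + p j"

definition Cset :: "('a \<Rightarrow> real) \<Rightarrow> ('a \<Rightarrow> real) \<Rightarrow> 'a set \<Rightarrow> real \<Rightarrow> 'a \<Rightarrow> real set" where
  "Cset p w J' to a = {c_aj p w a j | j. j \<in> J' - {a} \<and> tstar_defined p w a j
        \<and> c_aj p w a j \<in> {to<..<t_end p J' to}} \<union> {to, t_end p J' to}"

text \<open>m = number of distinct points; c r = r-th smallest point (1-indexed).\<close>
definition m_pts :: "('a \<Rightarrow> real) \<Rightarrow> ('a \<Rightarrow> real) \<Rightarrow> 'a set \<Rightarrow> real \<Rightarrow> 'a \<Rightarrow> nat" where
  "m_pts p w J' to a = card (Cset p w J' to a)"

definition cpt :: "('a \<Rightarrow> real) \<Rightarrow> ('a \<Rightarrow> real) \<Rightarrow> 'a set \<Rightarrow> real \<Rightarrow> 'a \<Rightarrow> nat \<Rightarrow> real" where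
  "cpt p w J' to a r = sorted_list_of_set (Cset p w J' to a) ! (r - 1)"

definition Mlab :: "('a \<Rightarrow> real) \<Rightarrow> ('a \<Rightarrow> real) \<Rightarrow> 'a set \<Rightarrow> real \<Rightarrow> 'a \<Rightarrow> 'a \<Rightarrow> nat" where
  "Mlab p w J' to a j =
     (if j = a then 1
      else if tstar_defined p w a j \<and> tstar p w a j \<in> {to<..<t_end p J' to}
              \<and> (\<exists>r. 1 \<le> r \<and> r \<le> m_pts p w J' to a \<and> c_aj p w a j = cpt p w J' to a r)
           then (THE r. 1 \<le> r \<and> r \<le> m_pts p w J' to a \<and> c_aj p w a j = cpt p w J' to a r)
      else card J' + 1)"

definition Jl :: "('a \<Rightarrow> real) \<Rightarrow> ('a \<Rightarrow> real) \<Rightarrow> 'a set \<Rightarrow> real \<Rightarrow> 'a \<Rightarrow> nat \<Rightarrow> 'a set" where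
  "Jl p w J' to a q = {j \<in> J' - {a}. Mlab p w J' to a j \<le> q}"

definition Jr :: "('a \<Rightarrow> real) \<Rightarrow> ('a \<Rightarrow> real) \<Rightarrow> 'a set \<Rightarrow> real \<Rightarrow> 'a \<Rightarrow> nat \<Rightarrow> 'a set" where
  "Jr p w J' to a q = {j \<in> J'. Mlab p w J' to a j > q}"

definition s_q :: "('a \<Rightarrow> real) \<Rightarrow> ('a \<Rightarrow> real) \<Rightarrow> 'a set \<Rightarrow> real \<Rightarrow> 'a \<Rightarrow> nat \<Rightarrow> real" where
  "s_q p w J' to a q = to + sum p (Jl p w J' to a q)"

definition feasible_q :: "'a set \<Rightarrow> ('a \<Rightarrow> real) \<Rightarrow> ('a \<Rightarrow> real) \<Rightarrow> 'a set \<Rightarrow> real \<Rightarrow> 'a \<Rightarrow> nat set" where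
  "feasible_q J p w J' to a = {q. 1 \<le> q \<and> q \<le> m_pts p w J' to a - 1
      \<and> cpt p w J' to a q \<le> s_q p w J' to a q \<and> s_q p w J' to a q < cpt p w J' to a (Suc q)
      \<and> s_q p w J' to a q \<notin> banned J p w a}"

text \<open>fast_schedule J p w J' t v sigma: the call FastSchedule(J',t) may return value v and sequence sigma.
  The relation accounts for all admissible tie-breaking choices (choice of alpha among equally ranked
  jobs, choice among candidates of equal maximum value).\<close>
inductive fast_schedule :: "'a set \<Rightarrow> ('a \<Rightarrow> real) \<Rightarrow> ('a \<Rightarrow> real) \<Rightarrow> 'a set \<Rightarrow> real \<Rightarrow> real \<Rightarrow> 'a list \<Rightarrow> bool"
  for J :: "'a set" and p :: "'a \<Rightarrow> real" and w :: "'a \<Rightarrow> real"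
where
  fs_empty: "fast_schedule J p w {} t 0 []"
| fs_single: "fast_schedule J p w {j} t (w j / (p j + t)) [j]"
| fs_step: "\<lbrakk> finite J'; 2 \<le> card J'; is_alpha p w J' t a;
      \<forall>q \<in> feasible_q J p w J' t a.
          fast_schedule J p w (Jl p w J' t a q) t (vl q) (sl q)
        \<and> fast_schedule J p w (Jr p w J' t a q) (s_q p w J' t a q + p a) (vr q) (sr q);
      q0 \<in> feasible_q J p w J' t a;
      \<forall>q \<in> feasible_q J p w J' t a.
          vl q + vr q + w a / (s_q p w J' t a q + p a)
        \<le> vl q0 + vr q0 + w a / (s_q p w J' t a q0 + p a) \<rbrakk>
    \<Longrightarrow> fast_schedule J p w J' t
          (vl q0 + vr q0 + w a / (s_q p w J' t a q0 + p a)) (sl q0 @ [a] @ sr q0)"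

end

theory Submission
  imports Defs
begin

text \<open>
  Exchanging adjacent jobs \<open>i\<close>, \<open>j\<close> that start at time \<open>t\<close> is governed by the sign of
  \<open>\<phi>\<^sub>i(t) - \<phi>\<^sub>j(t)\<close>, which changes at most once. Local precedence implies global precedence: if
  \<open>\<phi>\<^sub>i \<ge> \<phi>\<^sub>j\<close> at the relevant times, an optimal schedule cannot contain \<open>j X i\<close> with \<open>X\<close> nonempty
  unless \<open>i\<close> and \<open>j\<close> are identical. Hence in a suitably chosen optimal schedule of a subproblem the
  start time \<open>s\<close> of \<open>\<alpha>\<close> avoids every interval \<open>[t\<^sup>*\<^sub>\<alpha>\<^sub>j, c\<^sub>\<alpha>\<^sub>j)\<close>, and the jobs preceding \<open>\<alpha>\<close> are exactly
  those with \<open>t\<^sup>*\<^sub>\<alpha>\<^sub>j\<close> in the time window and \<open>c\<^sub>\<alpha>\<^sub>j \<le> s\<close>; this schedule is a candidate of the procedure.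
  The banned intervals of \<open>\<alpha>\<close> that come from jobs outside the subproblem never meet its time window,
  so every recursive call has a feasible candidate.
\<close>

section \<open>Value of a sequence started at an arbitrary time\<close>

fun sval :: "('a \<Rightarrow> real) \<Rightarrow> ('a \<Rightarrow> real) \<Rightarrow> real \<Rightarrow> 'a list \<Rightarrow> real" where
  "sval p w t [] = 0"
| "sval p w t (x # xs) = w x / (t + p x) + sval p w (t + p x) xs"

abbreviation len :: "('a \<Rightarrow> real) \<Rightarrow> 'a list \<Rightarrow> real" where
  "len p xs \<equiv> sum_list (map p xs)"

lemma sval_append: "sval p w t (xs @ ys) = sval p w t xs + sval p w (t + len p xs) ys"
  by (induction xs arbitrary: t) (auto simp: add.assoc)

lemma sval_eq_sum:
  "sval p w t xs = (\<Sum>k<length xs. w (xs ! k) / (t + len p (take (Suc k) xs)))"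
proof (induction xs arbitrary: t)
  case (Cons x xs)
  then show ?case by (simp add: sum.lessThan_Suc_shift add.assoc del: sum.lessThan_Suc)
qed simp

lemma sched_val_eq_sval: "sched_val p w xs = sval p w 0 xs"
  by (simp add: sched_val_def compl_time_def sval_eq_sum)

section \<open>Inequalities behind exchanging two jobs around a block\<close>

lemma frac_shift_ineq:
  fixes y :: real
  assumes "0 < Y" "Y \<le> T" "0 < c" "0 \<le> x" "x \<le> y" "y \<le> z"
  shows "(y - x) * (c / (Y + y) - c / (Y + z)) * (T + z)
       \<le> (z - y) * (T + x) * (c / (Y + x) - c / (Y + y))"
proof -
  have pos: "Y + x > 0" "Y + y > 0" "Y + z > 0" using assms by auto
  \<comment> \<open>Up to the common factor \<open>(y - x) * (z - y) * c / (Y + y)\<close> this is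
    the claim itself; it holds since \<open>Y \<le> T\<close> makes \<open>(T + q) / (Y + q)\<close>
    nonincreasing in \<open>q\<close>.\<close>
  have "(T + z) / (Y + z) \<le> (T + x) / (Y + x)"
  proof -
    have "(z - x) * (T - Y) \<ge> 0" using assms by simp
    then have "(T + z) * (Y + x) \<le> (T + x) * (Y + z)" by (simp add: algebra_simps)
    then show ?thesis using pos by (simp add: divide_le_eq pos_le_divide_eq field_simps)
  qed
  moreover have "(y - x) * (z - y) * c / (Y + y) \<ge> 0" using assms pos by simp
  ultimately have "((y - x) * (z - y) * c / (Y + y)) * ((T + z) / (Y + z))
      \<le> ((y - x) * (z - y) * c / (Y + y)) * ((T + x) / (Y + x))" by (rule mult_left_mono)
  moreover have "c / (Y + y) - c / (Y + z) = c * (z - y) / ((Y + y) * (Y + z))"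
    "c / (Y + x) - c / (Y + y) = c * (y - x) / ((Y + x) * (Y + y))"
    using pos by (simp_all add: field_simps)
  ultimately show ?thesis by (simp add: mult_ac)
qed

text \<open>The value of a block is convex in its shift. The factors \<open>T + z\<close> and
  \<open>T + x\<close> sharpen plain convexity and survive summation because every unshifted
  completion time in the block is at most \<open>T\<close>. The sharper form allows the three block
  values to be eliminated in the two lemmas below.\<close>

lemma sval_shift_ineq:
  assumes "\<forall>k\<in>set xs. 0 < p k \<and> 0 < w k" "0 \<le> t" "t + len p xs \<le> T"
    "0 \<le> x" "x \<le> y" "y \<le> z"
  shows "(y - x) * (sval p w (t + y) xs - sval p w (t + z) xs) * (T + z)
       \<le> (z - y) * (T + x) * (sval p w (t + x) xs - sval p w (t + y) xs)"
  using assms(1-3)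
proof (induction xs arbitrary: t)
  case (Cons k xs)
  have l: "len p xs \<ge> 0" using Cons.prems by (intro sum_list_nonneg) auto
  have eq: "t + p k + q = t + q + p k" for q by simp
  have "(y - x) * (sval p w (t + p k + y) xs - sval p w (t + p k + z) xs) * (T + z)
       \<le> (z - y) * (T + x) * (sval p w (t + p k + x) xs - sval p w (t + p k + y) xs)"
    using Cons.prems by (intro Cons.IH) auto
  moreover have "(y - x) * (w k / (t + p k + y) - w k / (t + p k + z)) * (T + z)
       \<le> (z - y) * (T + x) * (w k / (t + p k + x) - w k / (t + p k + y))"
    using Cons.prems l assms(4-) by (intro frac_shift_ineq) auto
  ultimately show ?case by (simp add: eq algebra_simps)
qed simp

text \<open>Here \<open>a\<close>, \<open>b\<close> are the lengths of \<open>i\<close>,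
  \<open>j\<close>, the numbers \<open>v\<close>, \<open>u\<close> their densities (weight over
  length), and \<open>A\<close>, \<open>B\<close>, \<open>D\<close> the values of the block
  \<open>X\<close> at offsets \<open>a\<close>, \<open>b\<close>, \<open>a + b\<close> from
  \<open>t\<close>. \<open>O3\<close> bounds \<open>A - B\<close> from above, \<open>O2\<close>
  bounds \<open>B - D\<close> from below, and \<open>sh\<close> makes the two bounds incompatible
  given dominance at \<open>t + L\<close>.\<close>

lemma gap_contradiction_le:
  fixes a b t L u v A B D :: real
  assumes pos: "0 < a" "0 < b" "0 \<le> t" "0 < L" "0 < u" "0 < v" and ab: "a \<le> b"
    and dom: "u * (a + (t + L)) \<le> v * (b + (t + L))" and ne: "\<not> (a = b \<and> u = v)"
    and O3: "v * a / (t + a) + A + u * b / (t + L + a + b) \<le> u * b / (t + b) + B + v * a / (t + L + a + b)"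
    and O2: "v * a / (t + a) + u * b / (t + a + b) + D \<le> u * b / (t + b) + B + v * a / (t + L + a + b)"
    and sh: "(b - a) * (B - D) * (t + L + a + b) \<le> a * (t + L + a) * (A - B)"
  shows False
proof -
  define T Z where "T = t + L" and "Z = t + L + a + b"
  have p: "t + a > 0" "t + b > 0" "t + a + b > 0" "Z > 0" "T + a > 0" "T + b > 0" "T > 0"
    using pos by (auto simp: Z_def T_def)
  define R3 where "R3 = (u * b * (L + a) / (t + b) - v * a * (L + b) / (t + a)) / Z"
  define R2 where "R2 = v * a * (L + b) / ((t + a) * Z) - u * a * b / ((t + b) * (t + a + b))"
  have va: "v * a / (t + a) - v * a / Z = v * a * (L + b) / ((t + a) * Z)"
    using p by (simp add: field_simps) (simp add: Z_def algebra_simps)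
  have ub: "u * b / (t + b) - u * b / Z = u * b * (L + a) / ((t + b) * Z)"
    using p by (simp add: field_simps) (simp add: Z_def algebra_simps)
  have ub2: "u * b / (t + b) - u * b / (t + a + b) = u * a * b / ((t + b) * (t + a + b))"
    using p by (simp add: field_simps)
  have "A - B \<le> R3" using O3 va ub unfolding R3_def Z_def[symmetric] by (simp add: diff_divide_distrib)
  moreover have "B - D \<ge> R2" using O2 va ub2 unfolding R2_def Z_def[symmetric] by linarith
  \<comment> \<open>The block values disappear here; only lengths, densities and times
    remain.\<close>
  ultimately have "(b - a) * R2 * Z \<le> a * (T + a) * R3"
  proof -
    assume h: "A - B \<le> R3" "R2 \<le> B - D"
    have "(b - a) * R2 * Z \<le> (b - a) * (B - D) * Z"
      using h(2) ab p by (intro mult_right_mono mult_left_mono) auto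
    also have "\<dots> \<le> a * (T + a) * (A - B)" using sh by (simp add: Z_def T_def)
    also have "\<dots> \<le> a * (T + a) * R3" using h(1) pos p by (intro mult_left_mono) auto
    finally show ?thesis .
  qed
  then have "((b - a) * R2 * Z) * (Z / (a * b)) \<le> (a * (T + a) * R3) * (Z / (a * b))"
    using p pos by (intro mult_right_mono) auto
  moreover have "(e * R2 * Z) * (Z / (a * b)) =
     e * Z * (v * (L + b) / (b * (t + a))) - u * e * Z\<^sup>2 / ((t + b) * (t + a + b))" for e
    using p pos unfolding R2_def by (simp add: right_diff_distrib left_diff_distrib power2_eq_square mult_ac)
  moreover have "(a * e * R3) * (Z / (a * b)) =
     u * (L + a) * e / (t + b) - e * a * (v * (L + b) / (b * (t + a)))" for e
    using p pos unfolding R3_def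
    by (simp add: right_diff_distrib left_diff_distrib diff_divide_distrib mult_ac)
  ultimately have "(b - a) * Z * (v * (L + b) / (b * (t + a))) - u * (b - a) * Z\<^sup>2 / ((t + b) * (t + a + b))
      \<le> u * (L + a) * (T + a) / (t + b) - (T + a) * a * (v * (L + b) / (b * (t + a)))"
    by (simp only:)
  moreover have "(b - a) * Z * x + (T + a) * a * x = b * (T + b) * x" for x
    by (simp add: Z_def T_def algebra_simps)
  ultimately have "b * (T + b) * (v * (L + b) / (b * (t + a)))
      \<le> u * (L + a) * (T + a) / (t + b) + u * (b - a) * Z\<^sup>2 / ((t + b) * (t + a + b))"
    by (smt (verit))
  then have main: "(T + b) * v * (L + b) / (t + a)
      \<le> u * (L + a) * (T + a) / (t + b) + u * (b - a) * Z\<^sup>2 / ((t + b) * (t + a + b))"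
    using pos by (simp add: mult_ac)
  \<comment> \<open>If \<open>(T + b) * v\<close> is lowered to its bound \<open>u * (T + a)\<close>
    from \<open>dom\<close>, then \<open>main\<close> fails by exactly this product. It is positive
    for \<open>a < b\<close>; for \<open>a = b\<close> it vanishes, and strictness comes from
    \<open>ne\<close>.\<close>
  have idn: "u * (T + a) * (L + b) / (t + a) - u * (L + a) * (T + a) / (t + b)
       - u * (b - a) * Z\<^sup>2 / ((t + b) * (t + a + b))
     = u * (b - a) * Z / (t + b) * (b * L / ((t + a) * (t + a + b)))"
  proof -
    have "(L + b) / (t + a) - (L + a) / (t + b) = (b - a) * Z / ((t + a) * (t + b))"
      using p by (simp add: field_simps) (simp add: Z_def algebra_simps)
    moreover have "(T + a) / (t + a) - Z / (t + a + b) = b * L / ((t + a) * (t + a + b))"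
      using p by (simp add: field_simps) (simp add: Z_def T_def algebra_simps)
    moreover have "u * (T + a) * (L + b) / (t + a) - u * (L + a) * (T + a) / (t + b)
      = u * (T + a) * ((L + b) / (t + a) - (L + a) / (t + b))"
      by (simp add: algebra_simps)
    moreover have "u * (T + a) * (e * Z / ((t + a) * (t + b))) - u * e * Z\<^sup>2 / ((t + b) * (t + a + b))
      = u * e * Z / (t + b) * ((T + a) / (t + a) - Z / (t + a + b))" for e
      by (simp add: right_diff_distrib diff_divide_distrib power2_eq_square mult_ac)
    ultimately show ?thesis by metis
  qed
  have le: "u * (T + a) * (L + b) / (t + a) \<le> (T + b) * v * (L + b) / (t + a)"
    using dom p pos by (intro divide_right_mono mult_right_mono) (auto simp: T_def algebra_simps)
  show False
  proof (cases "a = b")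
    case True
    then have "u < v" using dom ne p pos by (auto simp: T_def)
    then have "u * (T + a) * (L + b) / (t + a) < (T + b) * v * (L + b) / (t + a)"
      using True p pos by (intro divide_strict_right_mono mult_strict_right_mono) auto
    then show False using main idn True by (simp add: mult_ac)
  next
    case False
    then have "u * (b - a) * Z / (t + b) * (b * L / ((t + a) * (t + a + b))) > 0"
      using ab p pos by simp
    then show False using main idn le by linarith
  qed
qed

text \<open>The same elimination for \<open>b < a\<close>, where \<open>D\<close> is the value of
  the block moved in front of both jobs and dominance enters at \<open>t\<close>, the start of the
  pattern.\<close>

lemma gap_contradiction_gt:
  fixes a b t L u v A B D :: real
  assumes pos: "0 < a" "0 < b" "0 \<le> t" "0 < L" "0 < u" "0 < v" and ab: "b < a"
    and dom: "u * (a + t) \<le> v * (b + t)"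
    and O3: "v * a / (t + a) + A + u * b / (t + L + a + b) \<le> u * b / (t + b) + B + v * a / (t + L + a + b)"
    and O1: "D + v * a / (t + L + a) + u * b / (t + L + a + b) \<le> u * b / (t + b) + B + v * a / (t + L + a + b)"
    and sh: "b * (B - A) * (t + L + a) \<le> (a - b) * (t + L) * (D - B)"
  shows False
proof -
  define T Z where "T = t + L" and "Z = t + L + a + b"
  have p: "t + a > 0" "t + b > 0" "Z > 0" "T + a > 0" "T > 0"
    using pos by (auto simp: Z_def T_def)
  \<comment> \<open>The rescaling turns dominance at \<open>t\<close> into \<open>u \<le> V\<close>
    and gives the bounds the common denominator \<open>(t + b) * Z\<close>.\<close>
  define V where "V = v * (t + b) / (t + a)"
  have uV: "u \<le> V" using dom p by (simp add: V_def field_simps)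
  have v: "v = V * (t + a) / (t + b)" using p by (simp add: V_def)
  have "1 / (t + a) - 1 / Z = (L + b) / ((t + a) * Z)"
    using p by (simp add: field_simps) (simp add: Z_def algebra_simps)
  then have "v * a * (1 / (t + a) - 1 / Z) = V * a * (L + b) / ((t + b) * Z)"
    using p unfolding v by (simp add: mult_ac)
  then have va: "v * a / (t + a) - v * a / Z = V * a * (L + b) / ((t + b) * Z)"
    by (simp add: right_diff_distrib)
  have "1 / (T + a) - 1 / Z = b / ((T + a) * Z)"
    using p by (simp add: field_simps) (simp add: Z_def T_def algebra_simps)
  then have "v * a * (1 / (T + a) - 1 / Z) = V * a * b * (t + a) / ((t + b) * (T + a) * Z)"
    using p unfolding v by (simp add: mult_ac)
  then have va2: "v * a / (T + a) - v * a / Z = V * a * b * (t + a) / ((t + b) * (T + a) * Z)"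
    by (simp add: right_diff_distrib)
  have ub: "u * b / (t + b) - u * b / Z = u * b * (L + a) / ((t + b) * Z)"
    using p by (simp add: field_simps) (simp add: Z_def algebra_simps)
  define R3 where "R3 = (V * a * (L + b) - u * b * (L + a)) / ((t + b) * Z)"
  define R1 where "R1 = (u * b * (L + a) - V * a * b * (t + a) / (T + a)) / ((t + b) * Z)"
  have "R3 \<le> B - A" using O3 va ub unfolding R3_def Z_def[symmetric] by (simp add: diff_divide_distrib)
  moreover have "D - B \<le> R1"
  proof -
    have "R1 = u * b * (L + a) / ((t + b) * Z) - V * a * b * (t + a) / ((t + b) * (T + a) * Z)"
      by (simp add: R1_def diff_divide_distrib mult_ac)
    then show ?thesis using O1 va2 ub unfolding Z_def T_def by linarith
  qed
  ultimately have "b * R3 * (T + a) \<le> (a - b) * T * R1"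
  proof -
    assume h: "R3 \<le> B - A" "D - B \<le> R1"
    have "b * R3 * (T + a) \<le> b * (B - A) * (T + a)"
      using h(1) pos p by (intro mult_right_mono mult_left_mono) auto
    also have "\<dots> \<le> (a - b) * T * (D - B)" using sh by (simp add: T_def)
    also have "\<dots> \<le> (a - b) * T * R1" using h(2) ab p by (intro mult_left_mono) auto
    finally show ?thesis .
  qed
  then have "(b * R3 * (T + a)) * ((t + b) * Z / b) \<le> ((a - b) * T * R1) * ((t + b) * Z / b)"
    using p pos by (intro mult_right_mono) auto
  moreover have "(b * R3 * (T + a)) * ((t + b) * Z / b) = (V * a * (L + b) - u * b * (L + a)) * (T + a)"
    using p pos unfolding R3_def by simp
  moreover have "(e * R1) * ((t + b) * Z / b) = e * (u * (L + a) - V * a * (t + a) / (T + a))" for e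
    using p pos unfolding R1_def
    by (simp add: right_diff_distrib left_diff_distrib diff_divide_distrib mult_ac)
  ultimately have "(V * a * (L + b) - u * b * (L + a)) * (T + a)
     \<le> (a - b) * T * (u * (L + a) - V * a * (t + a) / (T + a))" by (simp only:)
  then have "V * a * (L + b) * (T + a) + (a - b) * T * (V * a * (t + a) / (T + a))
     \<le> u * (L + a) * (b * (T + a) + (a - b) * T)" by (simp add: algebra_simps)
  also have "\<dots> = u * (a * (L + a) * (T + b))" by (simp add: algebra_simps)
  also have "\<dots> \<le> V * (a * (L + a) * (T + b))"
    using uV p pos by (intro mult_right_mono) (auto simp: T_def)
  \<comment> \<open>With \<open>u\<close> replaced by \<open>V\<close> the inequality is homogeneous
    in \<open>V\<close>; the bracket equals \<open>(a - b) * (a * L / (T + a))\<close>, which is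
    positive.\<close>
  finally have "V * a * ((L + b) * (T + a) - (L + a) * (T + b) + (a - b) * T * ((t + a) / (T + a))) \<le> 0"
    by (simp add: algebra_simps)
  moreover have "(L + b) * (T + a) - (L + a) * (T + b) + (a - b) * T * ((t + a) / (T + a))
     = (a - b) * (a * L / (T + a))"
    using p by (simp add: field_simps) (simp add: T_def algebra_simps)
  moreover have "V * a * ((a - b) * (a * L / (T + a))) > 0" 
  proof -
    have "V > 0" using uV pos by linarith
    then show ?thesis using ab p pos by simp
  qed
  ultimately show False by simp
qed

section \<open>Optimal schedules of a subproblem\<close>

definition opt :: "('a \<Rightarrow> real) \<Rightarrow> ('a \<Rightarrow> real) \<Rightarrow> 'a set \<Rightarrow> real \<Rightarrow> 'a list \<Rightarrow> bool" where
  "opt p w J' t \<sigma> \<longleftrightarrow> is_schedule J' \<sigma> \<and> (\<forall>\<tau>. is_schedule J' \<tau> \<longrightarrow> sval p w t \<tau> \<le> sval p w t \<sigma>)"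

lemma finite_schedules: "finite J' \<Longrightarrow> finite {\<sigma>. is_schedule J' \<sigma>}"
  by (rule finite_subset[OF _ finite_subset_distinct]) (auto simp: is_schedule_def)

lemma is_schedule_singleton_iff: "is_schedule {j} \<tau> \<longleftrightarrow> \<tau> = [j]"
proof
  assume "is_schedule {j} \<tau>"
  then have "length \<tau> = 1" "set \<tau> = {j}" by (auto simp: is_schedule_def distinct_card[symmetric])
  then show "\<tau> = [j]" by (cases \<tau>) auto
qed (simp add: is_schedule_def)

lemma len_eq_sum: "distinct xs \<Longrightarrow> len p xs = sum p (set xs)"
  by (simp add: sum_list_distinct_conv_sum_set)

lemma finite_argmax:
  fixes f :: "'b \<Rightarrow> real"
  assumes "finite S" "S \<noteq> {}"
  shows "\<exists>x\<in>S. \<forall>y\<in>S. f y \<le> f x"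
proof -
  have "Max (f ` S) \<in> f ` S" using assms by (intro Max_in) auto
  then obtain x where "x \<in> S" "f x = Max (f ` S)" by auto
  then show ?thesis using assms by (intro bexI[of _ x]) auto
qed

lemma opt_exists:
  assumes "finite J'"
  shows "\<exists>\<sigma>. opt p w J' t \<sigma>"
proof -
  let ?S = "{\<sigma>. is_schedule J' \<sigma>}"
  have "?S \<noteq> {}" using finite_distinct_list[OF assms] by (auto simp: is_schedule_def)
  then obtain \<sigma> where "\<sigma> \<in> ?S" "\<forall>\<tau>\<in>?S. sval p w t \<tau> \<le> sval p w t \<sigma>"
    using finite_argmax[OF finite_schedules[OF assms]] by metis
  then show ?thesis by (auto simp: opt_def)
qed

lemma nth_sorted_list_of_set_less_iff:
  fixes C :: "real set"
  assumes "i < card C" "k < card C"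
  shows "sorted_list_of_set C ! i < sorted_list_of_set C ! k \<longleftrightarrow> i < k"
proof -
  have "sorted_list_of_set C ! x < sorted_list_of_set C ! y" if "x < y" "y < card C" for x y
    using that strict_sorted_list_of_set[of C] by (intro sorted_wrt_nth_less[of "(<)"]) auto
  then show ?thesis using assms by (metis linorder_neqE_nat order_less_asym order_less_irrefl)
qed

section \<open>Order changes between two jobs, and exchange arguments\<close>

locale jobs =
  fixes J :: "'a set" and p w :: "'a \<Rightarrow> real"
  assumes finite_J: "finite J"
    and p_pos: "j \<in> J \<Longrightarrow> 0 < p j"
    and w_pos: "j \<in> J \<Longrightarrow> 0 < w j"
begin

lemma phi_le_iff:
  assumes "i \<in> J" "j \<in> J" "0 \<le> t"
  shows "phi p w j t \<le> phi p w i t \<longleftrightarrow> w j * p i * (p i + t) \<le> w i * p j * (p j + t)"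
proof -
  have pos: "0 < p i * (p i + t)" "0 < p j * (p j + t)"
    using assms p_pos by (auto intro!: mult_pos_pos add_pos_nonneg)
  have "y / B \<le> x / A \<longleftrightarrow> y * A \<le> x * B" if "0 < A" "0 < B" for x y A B :: real
    using that by (simp add: field_simps)
  from this[OF pos] show ?thesis by (simp add: phi_def mult.assoc)
qed

text \<open>Up to a positive factor, \<open>phi p w i t - phi p w j t\<close> is affine in
  \<open>t\<close> with slope \<open>w i * p j - w j * p i\<close> and root
  \<open>tstar p w i j\<close>, so the order of two jobs changes at most once.\<close>

lemma phi_le_iff_tstar:
  assumes "i \<in> J" "j \<in> J" "0 \<le> t" "tstar_defined p w i j"
  shows "phi p w j t \<le> phi p w i t \<longleftrightarrow> 0 \<le> (w i * p j - w j * p i) * (t - tstar p w i j)"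
proof -
  have "(w i * p j - w j * p i) * tstar p w i j = w j * (p i)\<^sup>2 - w i * (p j)\<^sup>2"
    using assms(4) by (simp add: tstar_def tstar_defined_def)
  then have "(w i * p j - w j * p i) * (t - tstar p w i j)
     = w i * p j * (p j + t) - w j * p i * (p i + t)"
    unfolding right_diff_distrib by (simp add: algebra_simps power2_eq_square)
  then show ?thesis using phi_le_iff[OF assms(1-3)] by simp
qed

lemma tstar_defined_sym: "tstar_defined p w i j \<longleftrightarrow> tstar_defined p w j i"
  by (auto simp: tstar_defined_def)

lemma tstar_sym: "tstar p w i j = tstar p w j i"
  unfolding tstar_def by (metis minus_diff_eq minus_divide_divide)

text \<open>An affine function is never below both of its end values. If there is no root, the
  comparison reduces to \<open>p i \<le> p j\<close> at every time.\<close>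

lemma phi_le_between:
  assumes "i \<in> J" "j \<in> J" "0 \<le> x" "x \<le> t" "t \<le> y"
    and "phi p w j x \<le> phi p w i x" "phi p w j y \<le> phi p w i y"
  shows "phi p w j t \<le> phi p w i t"
proof (cases "tstar_defined p w i j")
  case True
  let ?m = "w i * p j - w j * p i"
  have "0 \<le> ?m * (x - tstar p w i j)" "0 \<le> ?m * (y - tstar p w i j)"
    using assms True by (auto simp: phi_le_iff_tstar)
  moreover have "?m * (x - tstar p w i j) \<le> ?m * (t - tstar p w i j) \<or> ?m * (y - tstar p w i j) \<le> ?m * (t - tstar p w i j)"
    using assms(4,5) by (cases "?m \<ge> 0") (auto intro: mult_left_mono mult_left_mono_neg)
  ultimately show ?thesis using assms True by (auto simp: phi_le_iff_tstar)
next
  case False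
  then have "w i * p j = w j * p i" by (simp add: tstar_defined_def)
  moreover have "0 < w j * p i" using assms p_pos w_pos by simp
  ultimately show ?thesis using assms by (simp add: phi_le_iff mult_le_cancel_left_pos)
qed

text \<open>If \<open>i\<close> weakly dominates \<open>j\<close>, the pattern \<open>j X i\<close> with nonempty \<open>X\<close> is improved by the better of
  \<open>i X j\<close> and \<open>i j X\<close> when \<open>p i \<le> p j\<close>, and by the better of \<open>i X j\<close> and \<open>X i j\<close> otherwise.\<close>
lemma opt_no_gap:
  assumes sub: "J' \<subseteq> J" and o: "opt p w J' t (pre @ j # X @ i # post)" and t: "0 \<le> t"
    and X: "X \<noteq> []"
    and d1: "phi p w j (t + len p pre) \<le> phi p w i (t + len p pre)"
    and d2: "phi p w j (t + len p pre + len p X) \<le> phi p w i (t + len p pre + len p X)"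
    and ne: "\<not> (p i = p j \<and> w i = w j)"
  shows False
proof -
  define s where "s = t + len p pre"
  define L where "L = len p X"
  have sch: "distinct (pre @ j # X @ i # post)" "set (pre @ j # X @ i # post) = J'"
    using o by (auto simp: opt_def is_schedule_def)
  then have inJ: "i \<in> J" "j \<in> J" "set X \<subseteq> J" "set pre \<subseteq> J" using sub by auto
  have "0 \<le> len p pre" using inJ p_pos by (intro sum_list_nonneg) (auto intro: less_imp_le)
  then have s: "0 \<le> s" using t by (simp add: s_def)
  have L: "0 < L"
  proof -
    obtain x xs where x: "X = x # xs" using X by (cases X) auto
    have "0 \<le> len p xs" using inJ p_pos x by (intro sum_list_nonneg) (auto intro: less_imp_le)
    then show ?thesis using p_pos[of x] inJ x by (simp add: L_def)
  qed
  note ac = add.assoc add.commute add.left_commute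
  have pw: "0 < p i" "0 < p j" "0 < w i" "0 < w j" using inJ p_pos w_pos by auto
  have posX: "\<forall>k\<in>set X. 0 < p k \<and> 0 < w k" using inJ p_pos w_pos by auto
  have le: "sval p w t \<tau> \<le> sval p w t (pre @ j # X @ i # post)" if "is_schedule J' \<tau>" for \<tau>
    using o that by (auto simp: opt_def)
  have "is_schedule J' (pre @ i # X @ j # post)" "is_schedule J' (pre @ i # j # X @ post)"
    "is_schedule J' (pre @ X @ i # j # post)"
    using sch by (auto simp: is_schedule_def)
  note le3 = this[THEN le]
  let ?u = "w j / p j" and ?v = "w i / p i"
  have O3: "?v * p i / (s + p i) + sval p w (s + p i) X + ?u * p j / (s + L + p i + p j)
     \<le> ?u * p j / (s + p j) + sval p w (s + p j) X + ?v * p i / (s + L + p i + p j)"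
    using le3(1) pw by (simp add: sval_append s_def L_def ac)
  have d1': "phi p w j s \<le> phi p w i s" and d2': "phi p w j (s + L) \<le> phi p w i (s + L)"
    using d1 d2 by (simp_all add: s_def L_def)
  have dom: "?u * (p i + y) \<le> ?v * (p j + y)" if "phi p w j y \<le> phi p w i y" "0 \<le> y" for y
    using that pw inJ by (simp add: phi_le_iff) (simp add: field_simps)
  have pos: "0 < p i" "0 < p j" "0 \<le> s" "0 < L" "0 < ?u" "0 < ?v" using pw s L by auto
  show False
  \<comment> \<open>The split orders the shifts of \<open>X\<close>: \<open>p i\<close>,
    \<open>p j\<close>, \<open>p i + p j\<close> in the first case and \<open>0\<close>,
    \<open>p j\<close>, \<open>p i\<close> in the second. The shift \<open>p j\<close> of the given
    optimal schedule is the middle one both times.\<close>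
  proof (cases "p i \<le> p j")
    case True
    show False
    proof (rule gap_contradiction_le[OF pos True _ _ O3])
      show "?u * (p i + (s + L)) \<le> ?v * (p j + (s + L))" using dom[OF d2'] s L by simp
      show "\<not> (p i = p j \<and> w j / p j = w i / p i)" using ne pw by auto
      show "?v * p i / (s + p i) + ?u * p j / (s + p i + p j) + sval p w (s + p i + p j) X
         \<le> ?u * p j / (s + p j) + sval p w (s + p j) X + ?v * p i / (s + L + p i + p j)"
        using le3(2) pw by (simp add: sval_append s_def L_def ac)
      show "(p j - p i) * (sval p w (s + p j) X - sval p w (s + p i + p j) X) * (s + L + p i + p j)
         \<le> p i * (s + L + p i) * (sval p w (s + p i) X - sval p w (s + p j) X)"
        using sval_shift_ineq[OF posX s, of "s + L" "p i" "p j" "p i + p j"] True pw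
        by (simp add: L_def add.assoc)
    qed
  next
    case False
    show False
    proof (rule gap_contradiction_gt[OF pos _ _ O3])
      show "p j < p i" using False by simp
      show "?u * (p i + s) \<le> ?v * (p j + s)" using dom[OF d1'] s by simp
      show "sval p w s X + ?v * p i / (s + L + p i) + ?u * p j / (s + L + p i + p j)
         \<le> ?u * p j / (s + p j) + sval p w (s + p j) X + ?v * p i / (s + L + p i + p j)"
        using le3(3) pw by (simp add: sval_append s_def L_def ac)
      show "p j * (sval p w (s + p j) X - sval p w (s + p i) X) * (s + L + p i)
         \<le> (p i - p j) * (s + L) * (sval p w s X - sval p w (s + p j) X)"
        using sval_shift_ineq[OF posX s, of "s + L" 0 "p j" "p i"] False pw
        by (simp add: L_def)
    qed
  qed
qed

text \<open>All terms outside the two positions cancel. Since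
  \<open>1 / (s + a) - 1 / (s + a + b)\<close> equals \<open>b / ((s + a) * (s + a + b))\<close>,
  the rest is a positive multiple of the difference of the two \<open>phi\<close> values.\<close>

lemma sval_swap_le_iff:
  assumes "i \<in> J" "j \<in> J" "0 \<le> t + len p pre"
  shows "sval p w t (pre @ j # i # post) \<le> sval p w t (pre @ i # j # post)
    \<longleftrightarrow> phi p w j (t + len p pre) \<le> phi p w i (t + len p pre)"
proof -
  define s where "s = t + len p pre"
  define a b where "a = p i" and "b = p j"
  have pos: "0 < a" "0 < b" "0 < s + a" "0 < s + b" "0 < s + a + b"
    using assms p_pos[of i] p_pos[of j] by (simp_all add: s_def a_def b_def)
  have "w i / (s + a) + w j / (s + a + b) - (w j / (s + b) + w i / (s + a + b))
     = (w i * b / (s + a) - w j * a / (s + b)) / (s + a + b)"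
  proof -
    have "1 / (s + a) - 1 / (s + a + b) = b / ((s + a) * (s + a + b))"
      "1 / (s + b) - 1 / (s + a + b) = a / ((s + b) * (s + a + b))"
      using pos by (simp_all add: field_simps)
    then have "w i * (1 / (s + a) - 1 / (s + a + b)) - w j * (1 / (s + b) - 1 / (s + a + b))
      = w i * (b / ((s + a) * (s + a + b))) - w j * (a / ((s + b) * (s + a + b)))" by simp
    then show ?thesis by (simp add: right_diff_distrib diff_divide_distrib)
  qed
  moreover have "sval p w t (pre @ i # j # post) - sval p w t (pre @ j # i # post)
     = w i / (s + a) + w j / (s + a + b) - (w j / (s + b) + w i / (s + a + b))"
    by (simp add: sval_append s_def a_def b_def add.assoc add.commute add.left_commute)
  ultimately have "sval p w t (pre @ j # i # post) \<le> sval p w t (pre @ i # j # post)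
    \<longleftrightarrow> 0 \<le> (w i * b / (s + a) - w j * a / (s + b)) / (s + a + b)" by linarith
  also have "\<dots> \<longleftrightarrow> w j * a / (s + b) \<le> w i * b / (s + a)"
    using pos by (simp add: zero_le_divide_iff)
  also have "\<dots> \<longleftrightarrow> w j * a * (a + s) \<le> w i * b * (b + s)"
    using pos by (simp add: field_simps)
  finally show ?thesis using phi_le_iff[OF assms(1,2)] assms(3) by (simp add: s_def a_def b_def)
qed

text \<open>Dominance before the root forces a negative slope, so \<open>i\<close> dominates exactly
  up to the root and \<open>j\<close> exactly from there on.\<close>

lemma phi_le_iff_le_tstar:
  assumes ij: "i \<in> J" "j \<in> J" "tstar_defined p w i j"
    and x: "0 \<le> x" "x < tstar p w i j" "phi p w j x \<le> phi p w i x" and y: "0 \<le> y"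
  shows "phi p w j y \<le> phi p w i y \<longleftrightarrow> y \<le> tstar p w i j"
    and "phi p w i y \<le> phi p w j y \<longleftrightarrow> tstar p w i j \<le> y"
proof -
  let ?m = "w i * p j - w j * p i" and ?s = "tstar p w i j"
  have "0 \<le> ?m * (x - ?s)" "?m \<noteq> 0"
    using ij x by (auto simp: phi_le_iff_tstar tstar_defined_def)
  then have m: "?m < 0" using x(2) by (smt (verit) zero_le_mult_iff)
  show "phi p w j y \<le> phi p w i y \<longleftrightarrow> y \<le> ?s"
    using m ij y by (subst phi_le_iff_tstar) (auto simp: zero_le_mult_iff)
  show "phi p w i y \<le> phi p w j y \<longleftrightarrow> ?s \<le> y"
    using m ij y tstar_defined_sym tstar_sym[of i j]
    by (subst phi_le_iff_tstar) (auto simp: zero_le_mult_iff)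
qed

section \<open>Crossing jobs and the structure of an optimum\<close>

definition crossing :: "'a set \<Rightarrow> real \<Rightarrow> 'a \<Rightarrow> 'a set" where
  "crossing J' t a = {j \<in> J' - {a}. tstar_defined p w a j \<and> tstar p w a j \<in> {t<..<t_end p J' t}}"

lemma crossing_phi_le_iff:
  assumes "is_alpha p w J' t a" "J' \<subseteq> J" "0 \<le> t" "j \<in> crossing J' t a" "0 \<le> y"
  shows "phi p w j y \<le> phi p w a y \<longleftrightarrow> y \<le> tstar p w a j"
    and "phi p w a y \<le> phi p w j y \<longleftrightarrow> tstar p w a j \<le> y"
  using phi_le_iff_le_tstar[of a j t y] assms by (auto simp: crossing_def is_alpha_def)

text \<open>The choice of \<open>a\<close> gives dominance at the start of the window. At its end,
  dominance comes from the tie-break if the jobs were equal at the start, and otherwise from the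
  absence of an order change inside the window. \<open>phi_le_between\<close> covers the
  interior.\<close>

lemma noncrossing_phi_le:
  assumes a: "is_alpha p w J' t a" and sub: "J' \<subseteq> J" and t: "0 \<le> t"
    and j: "j \<in> J'" "j \<notin> crossing J' t a" and y: "t \<le> y" "y \<le> t_end p J' t"
  shows "phi p w j y \<le> phi p w a y"
proof (cases "j = a")
  case False
  have inJ: "a \<in> J" "j \<in> J" using a sub j by (auto simp: is_alpha_def)
  have le: "phi p w j t \<le> phi p w a t" using a j by (auto simp: is_alpha_def)
  have "phi p w j (t_end p J' t) \<le> phi p w a (t_end p J' t)"
  proof (cases "phi p w j t = phi p w a t")
    case True
    then show ?thesis using a j by (auto simp: is_alpha_def)
  next
    case ne: False
    let ?m = "w a * p j - w j * p a" and ?s = "tstar p w a j"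
    show ?thesis
    proof (cases "tstar_defined p w a j")
      case True
      have "\<not> phi p w a t \<le> phi p w j t" using le ne by simp
      then have m: "?m * (t - ?s) > 0"
        using phi_le_iff_tstar[of j a t] inJ t True tstar_defined_sym tstar_sym[of a j]
        by (auto simp: algebra_simps)
      have "?s \<le> t \<or> t_end p J' t \<le> ?s" using j False True by (auto simp: crossing_def)
      then have "0 \<le> ?m * (t_end p J' t - ?s)"
        using m y by (auto simp: zero_less_mult_iff zero_le_mult_iff)
      then show ?thesis using inJ t y True by (auto simp: phi_le_iff_tstar)
    next
      case nd: False
      then have "w a * p j = w j * p a" by (simp add: tstar_defined_def)
      moreover have "0 < w j * p a" using inJ p_pos w_pos by simp
      ultimately show ?thesis using le inJ t y by (simp add: phi_le_iff mult_le_cancel_left_pos)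
    qed
  qed
  then show ?thesis using phi_le_between[OF inJ t y le] by simp
qed simp

text \<open>Ties force a choice among the optimal schedules: jobs identical to \<open>a\<close> are pushed behind \<open>a\<close>
  first, then adjacent ties are resolved by moving crossing jobs before \<open>a\<close> and the others behind.
  The weighted count \<open>wt\<close> of jobs preceding \<open>a\<close> increases with each such exchange.\<close>
lemma structured_optimum:
  assumes a: "is_alpha p w J' t a" and sub: "J' \<subseteq> J" and t: "0 \<le> t"
  shows "\<exists>l r. opt p w J' t (l @ a # r)
    \<and> set l = {j \<in> crossing J' t a. c_aj p w a j \<le> t + len p l}
    \<and> (\<forall>j\<in>crossing J' t a. t + len p l \<notin> {tstar p w a j ..< c_aj p w a j})"
proof -
  define N where "N = crossing J' t a"
  have fin: "finite J'" using sub finite_J finite_subset by blast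
  have aJ': "a \<in> J'" using a by (simp add: is_alpha_def)
  then have aJ: "a \<in> J" using sub by auto
  have nonneg: "0 \<le> len p xs" if "set xs \<subseteq> J" for xs
    using that p_pos by (intro sum_list_nonneg) (auto intro: less_imp_le)
  \<comment> \<open>Each job contributes at most 1, so the penalty \<open>card J' + 1\<close> for a
    job identical to \<open>a\<close> outweighs everything else that may precede
    \<open>a\<close>.\<close>
  define wt :: "'a \<Rightarrow> real" where
    "wt j = (if j \<in> N then 1 else if p j = p a \<and> w j = w a then - real (card J' + 1) else -1)" for j
  define \<Phi> where "\<Phi> \<sigma> = sum_list (map wt (takeWhile (\<lambda>x. x \<noteq> a) \<sigma>))" for \<sigma>
  have "finite {\<sigma>. opt p w J' t \<sigma>}"
    by (rule finite_subset[OF _ finite_schedules[OF fin]]) (auto simp: opt_def)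
  moreover have "{\<sigma>. opt p w J' t \<sigma>} \<noteq> {}" using opt_exists[OF fin] by auto
  ultimately obtain \<sigma> where \<sigma>: "opt p w J' t \<sigma>" and max: "\<And>\<tau>. opt p w J' t \<tau> \<Longrightarrow> \<Phi> \<tau> \<le> \<Phi> \<sigma>"
    using finite_argmax[of "{\<sigma>. opt p w J' t \<sigma>}" \<Phi>] by blast
  have "a \<in> set \<sigma>" using \<sigma> aJ' by (auto simp: opt_def is_schedule_def)
  then obtain l r where lr: "\<sigma> = l @ a # r" by (meson split_list)
  have \<Phi>_eq: "\<Phi> (l' @ a # r') = sum_list (map wt l')" if "opt p w J' t (l' @ a # r')" for l' r'
  proof -
    have "a \<notin> set l'" using that by (auto simp: opt_def is_schedule_def)
    then have "takeWhile (\<lambda>x. x \<noteq> a) (l' @ a # r') = l'" by (subst takeWhile_append2) auto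
    then show ?thesis by (simp add: \<Phi>_def)
  qed
  have mx: "sum_list (map wt l') \<le> sum_list (map wt l)" if "opt p w J' t (l' @ a # r')" for l' r'
    using max[OF that] \<Phi>_eq[OF that] \<Phi>_eq[of l r] \<sigma> lr by simp
  have o: "opt p w J' t (l @ a # r)" using \<sigma> lr by simp
  then have sch: "distinct (l @ a # r)" "set (l @ a # r) = J'" by (auto simp: opt_def is_schedule_def)
  have optI: "opt p w J' t \<tau>" if "is_schedule J' \<tau>" "sval p w t (l @ a # r) \<le> sval p w t \<tau>" for \<tau>
    using o that unfolding opt_def by (meson order_trans)
  have optD: "sval p w t \<tau> \<le> sval p w t (l @ a # r)" if "is_schedule J' \<tau>" for \<tau>
    using o that by (simp add: opt_def)
  define s where "s = t + len p l"
  have te: "t_end p J' t = s + p a + len p r"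
    using len_eq_sum[OF sch(1), of p] sch(2) by (simp add: t_end_def s_def)
  have lrJ: "set l \<subseteq> J" "set r \<subseteq> J" using sch sub by auto
  have before: "j \<in> N \<and> c_aj p w a j \<le> s" if jl: "j \<in> set l" for j
  proof -
    obtain pre X where l: "l = pre @ j # X" using jl by (meson split_list)
    define t0 where "t0 = t + len p pre"
    have j: "j \<in> J'" "j \<in> J" "j \<noteq> a" using jl sch lrJ by auto
    have nn: "0 \<le> len p pre" "0 \<le> len p X" "0 \<le> len p r" "0 < p j" "0 < p a"
      using nonneg lrJ l j aJ p_pos by auto
    have s: "s = t0 + p j + len p X" by (simp add: s_def t0_def l)
    have t0: "t \<le> t0" "0 \<le> t0" using t nn by (auto simp: t0_def)
    have scX: "is_schedule J' (pre @ a # X @ j # r)" using sch l by (auto simp: is_schedule_def)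
    have nid: "\<not> (p a = p j \<and> w a = w j)"
    proof
      assume id: "p a = p j \<and> w a = w j"
      then have jN: "j \<notin> N" by (simp add: N_def crossing_def tstar_defined_def)
      have "opt p w J' t (pre @ a # X @ j # r)"
        using scX id by (intro optI) (simp_all add: l sval_append)
      from mx[OF this] have "real (card J' + 1) \<le> sum_list (map wt X)"
        using id jN by (simp add: l wt_def)
      also have "\<dots> \<le> sum_list (map (\<lambda>_. 1) X)" by (intro sum_list_mono) (auto simp: wt_def)
      also have "\<dots> = card (set X)" using sch l by (simp add: sum_list_triv distinct_card)
      also have "card (set X) \<le> card J'" using fin sch l by (intro card_mono) auto
      finally show False by simp
    qed
    \<comment> \<open>If \<open>a\<close> dominates \<open>j\<close> over the span of
      \<open>X\<close>, then \<open>opt_no_gap\<close> makes \<open>X\<close> empty; the adjacent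
      swap is again optimal, and maximality forbids a negative weight of \<open>j\<close>.\<close>
    have nodom: "X = [] \<and> j \<in> N" if dom: "\<And>y. t0 \<le> y \<Longrightarrow> y \<le> t0 + len p X \<Longrightarrow> phi p w j y \<le> phi p w a y"
    proof
      show X: "X = []"
      proof (rule ccontr)
        assume X: "X \<noteq> []"
        have "opt p w J' t (pre @ j # X @ a # r)" using o l by simp
        from opt_no_gap[OF sub this t X _ _ nid] show False
          using dom[of t0] dom[of "t0 + len p X"] nn by (simp add: t0_def)
      qed
      have "sval p w t (pre @ j # a # r) \<le> sval p w t (pre @ a # j # r)"
        using sval_swap_le_iff[OF aJ j(2)] dom[of t0] t0 X by (simp add: t0_def)
      then have "opt p w J' t (pre @ a # j # r)" using scX X l by (intro optI) auto
      from mx[OF this] have "0 \<le> wt j" using X by (simp add: l)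
      then show "j \<in> N" by (auto simp: wt_def split: if_splits)
    qed
    have jN: "j \<in> N"
    proof (rule ccontr)
      assume jN: "j \<notin> N"
      have "phi p w j y \<le> phi p w a y" if "t0 \<le> y" "y \<le> t0 + len p X" for y
        using noncrossing_phi_le[OF a sub t j(1), of y] jN that t0 te s nn unfolding N_def by simp
      then show False using nodom jN by blast
    qed
    moreover have "c_aj p w a j \<le> s"
    proof (rule ccontr)
      assume "\<not> c_aj p w a j \<le> s"
      \<comment> \<open>As \<open>a\<close> starts at \<open>t0 + p j + len p X\<close>, the root
        lies beyond the span of \<open>X\<close>. Hence \<open>a\<close> strictly dominates
        \<open>j\<close> at \<open>t0\<close>, which contradicts optimality once \<open>X\<close> is
        empty.\<close>
      then have lt: "t0 + len p X < tstar p w a j" by (simp add: c_aj_def s)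
      have iff: "phi p w j y \<le> phi p w a y \<longleftrightarrow> y \<le> tstar p w a j"
        "phi p w a y \<le> phi p w j y \<longleftrightarrow> tstar p w a j \<le> y" if "0 \<le> y" for y
        using crossing_phi_le_iff[OF a sub t _ that, of j] jN unfolding N_def by auto
      have "X = []" using nodom iff(1) lt t0 by (smt (verit))
      moreover have "sval p w t (pre @ a # X @ j # r) \<le> sval p w t (l @ a # r)"
        using scX by (rule optD)
      ultimately have "phi p w a t0 \<le> phi p w j t0"
        using sval_swap_le_iff[OF j(2) aJ, of t pre r] t0 l by (simp add: t0_def)
      then show False using iff(2) t0 lt nn by (smt (verit))
    qed
    ultimately show ?thesis by simp
  qed
  \<comment> \<open>From its root on, \<open>j\<close> dominates \<open>a\<close>. If it came after
    \<open>a\<close> it would have to be adjacent, and the swap would yield an optimum of larger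
    weight count.\<close>
  have after: "j \<in> set l" if jN: "j \<in> N" and le: "tstar p w a j \<le> s" for j
  proof (rule ccontr)
    assume jl: "j \<notin> set l"
    have j: "j \<in> J'" "j \<noteq> a" "j \<in> J" using jN sub by (auto simp: N_def crossing_def)
    then have "j \<in> set r" using jl sch by auto
    then obtain X post where r: "r = X @ j # post" by (meson split_list)
    have s0: "0 \<le> s" using t nonneg lrJ by (simp add: s_def)
    have nn: "0 \<le> len p X" using nonneg lrJ r by auto
    have dom: "phi p w a y \<le> phi p w j y" if "s \<le> y" for y
      using crossing_phi_le_iff(2)[OF a sub t, of j y] jN that s0 le unfolding N_def by simp
    have nid: "\<not> (p j = p a \<and> w j = w a)"
      using jN by (auto simp: N_def crossing_def tstar_defined_def)
    have X: "X = []"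
    proof (rule ccontr)
      assume X: "X \<noteq> []"
      have "opt p w J' t (l @ a # X @ j # post)" using o r by simp
      from opt_no_gap[OF sub this t X _ _ nid] show False
        using dom[of s] dom[of "s + len p X"] nn by (simp add: s_def)
    qed
    have "sval p w t (l @ a # j # post) \<le> sval p w t (l @ j # a # post)"
      using sval_swap_le_iff[OF j(3) aJ, of t l post] dom[of s] s0 by (simp add: s_def)
    moreover have "is_schedule J' (l @ j # a # post)" using sch r X by (auto simp: is_schedule_def)
    ultimately have "opt p w J' t ((l @ [j]) @ a # post)" using r X by (intro optI) auto
    from mx[OF this] show False using jN by (simp add: wt_def)
  qed
  have "c_aj p w a j > tstar p w a j" if "j \<in> N" for j
    using that sub p_pos by (auto simp: c_aj_def N_def crossing_def)
  then have "set l = {j \<in> N. c_aj p w a j \<le> s}" "\<forall>j\<in>N. s \<notin> {tstar p w a j ..< c_aj p w a j}"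
    using before after by fastforce+
  then show ?thesis using o unfolding N_def s_def by blast
qed

section \<open>The points, the labels and the candidates\<close>

definition preceding :: "'a set \<Rightarrow> real \<Rightarrow> 'a \<Rightarrow> real \<Rightarrow> 'a set" where
  "preceding J' t a s = {j \<in> crossing J' t a. c_aj p w a j \<le> s}"

lemma finite_Cset: "finite J' \<Longrightarrow> finite (Cset p w J' t a)"
  unfolding Cset_def by simp

text \<open>This guarantees that the default label \<open>card J' + 1\<close> exceeds every
  admissible \<open>q\<close>, so jobs carrying it always go to the right. Each job other than
  \<open>a\<close> yields at most one point, and the two window ends are added.\<close>

lemma m_pts_le:
  assumes "finite J'" "a \<in> J'"
  shows "m_pts p w J' t a \<le> card J' + 1"
proof -
  have "Cset p w J' t a \<subseteq> c_aj p w a ` (J' - {a}) \<union> {t, t_end p J' t}"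
    by (auto simp: Cset_def)
  then have "m_pts p w J' t a \<le> card (c_aj p w a ` (J' - {a}) \<union> {t, t_end p J' t})"
    unfolding m_pts_def using assms by (intro card_mono) auto
  also have "\<dots> \<le> card (c_aj p w a ` (J' - {a})) + card {t, t_end p J' t}" by (rule card_Un_le)
  also have "\<dots> \<le> card (J' - {a}) + 2"
    using assms by (intro add_mono card_image_le) (auto simp: card_insert_if)
  also have "\<dots> = card J' + 1" using card_Suc_Diff1[OF assms] by simp
  finally show ?thesis .
qed

lemma cpt_less_iff:
  assumes "1 \<le> r" "r \<le> m_pts p w J' t a" "1 \<le> q" "q \<le> m_pts p w J' t a"
  shows "cpt p w J' t a r < cpt p w J' t a q \<longleftrightarrow> r < q"
  using assms unfolding cpt_def m_pts_def
  by (subst nth_sorted_list_of_set_less_iff) auto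

lemma cpt_in_Cset:
  assumes "finite J'" "1 \<le> r" "r \<le> m_pts p w J' t a"
  shows "cpt p w J' t a r \<in> Cset p w J' t a"
proof -
  have "cpt p w J' t a r \<in> set (sorted_list_of_set (Cset p w J' t a))"
    unfolding cpt_def using assms by (intro nth_mem) (auto simp: m_pts_def)
  then show ?thesis using finite_Cset[OF assms(1)] by simp
qed

lemma Cset_cptE:
  assumes "finite J'" "x \<in> Cset p w J' t a"
  obtains r where "1 \<le> r" "r \<le> m_pts p w J' t a" "cpt p w J' t a r = x"
proof -
  have "x \<in> set (sorted_list_of_set (Cset p w J' t a))" using assms finite_Cset by simp
  then obtain i where "i < m_pts p w J' t a" "sorted_list_of_set (Cset p w J' t a) ! i = x"
    by (auto simp: in_set_conv_nth m_pts_def)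
  then show ?thesis by (intro that[of "Suc i"]) (auto simp: cpt_def)
qed

lemma t_end_ge:
  assumes "J' \<subseteq> J"
  shows "t \<le> t_end p J' t"
proof -
  have "0 \<le> sum p J'" using assms p_pos by (intro sum_nonneg) (auto intro: less_imp_le)
  then show ?thesis by (simp add: t_end_def)
qed

lemma Cset_bounds:
  assumes "J' \<subseteq> J" "x \<in> Cset p w J' t a"
  shows "t \<le> x" "x \<le> t_end p J' t"
  using assms t_end_ge[OF assms(1), of t] by (auto simp: Cset_def)

lemma Mlab_le_iff:
  assumes sub: "J' \<subseteq> J" and a: "a \<in> J'" and j: "j \<in> J' - {a}"
    and q: "1 \<le> q" "q \<le> m_pts p w J' t a - 1"
  shows "Mlab p w J' t a j \<le> q \<longleftrightarrow> j \<in> crossing J' t a \<and> c_aj p w a j \<le> cpt p w J' t a q"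
proof -
  let ?m = "m_pts p w J' t a" and ?c = "cpt p w J' t a"
  have fin: "finite J'" using sub finite_J finite_subset by blast
  have m: "?m \<le> card J' + 1" using m_pts_le[OF fin a] .
  have qm: "q < ?m" using q by linarith
  show ?thesis
  proof (cases "j \<in> crossing J' t a \<and> (\<exists>r. 1 \<le> r \<and> r \<le> ?m \<and> c_aj p w a j = ?c r)")
    case True
    then obtain r where r: "1 \<le> r" "r \<le> ?m" "c_aj p w a j = ?c r" by blast
    have uniq: "r' = r" if "1 \<le> r' \<and> r' \<le> ?m \<and> c_aj p w a j = ?c r'" for r'
      using that r cpt_less_iff[of r J' t a r'] cpt_less_iff[of r' J' t a r]
      by (metis less_irrefl linorder_neqE_nat)
    have "(THE r. 1 \<le> r \<and> r \<le> ?m \<and> c_aj p w a j = ?c r) = r"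
      using r uniq by (intro the_equality) auto
    then have "Mlab p w J' t a j = r"
      using True j unfolding Mlab_def by (auto simp: crossing_def)
    moreover have "?c q < ?c r \<longleftrightarrow> q < r" using r q qm by (intro cpt_less_iff) auto
    ultimately show ?thesis using True r by (auto simp: not_less[symmetric])
  next
    case False
    then have M: "Mlab p w J' t a j = card J' + 1"
      using j unfolding Mlab_def by (auto simp: crossing_def)
    \<comment> \<open>No crossing job with a point up to \<open>c_q\<close> receives the default
      label: that point exceeds its root and hence \<open>t\<close>, and \<open>q < m\<close> keeps
      it below the window end, so it lies in \<open>Cset\<close>.\<close>
    have "\<not> c_aj p w a j \<le> ?c q" if jN: "j \<in> crossing J' t a"
    proof
      assume le: "c_aj p w a j \<le> ?c q"
      have "?c q < ?c (Suc q)" using q qm by (subst cpt_less_iff) auto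
      also have "\<dots> \<le> t_end p J' t"
        using Cset_bounds(2)[OF sub cpt_in_Cset[OF fin]] qm by simp
      finally have "c_aj p w a j < t_end p J' t" using le by simp
      moreover have "t < c_aj p w a j"
        using jN j sub p_pos[of j] by (auto simp: crossing_def c_aj_def)
      ultimately have "c_aj p w a j \<in> Cset p w J' t a"
        using jN by (auto simp: Cset_def crossing_def)
      then show False using False jN Cset_cptE[OF fin] by metis
    qed
    then show ?thesis using M m qm by auto
  qed
qed

text \<open>No point of \<open>Cset\<close> lies strictly between \<open>c_q\<close> and its
  successor, so cutting at \<open>c_q\<close> and cutting at \<open>s\<close> give the same split.
  This frees the later arguments from indices and labels.\<close>

lemma Jl_Jr_eq:
  assumes sub: "J' \<subseteq> J" and a: "a \<in> J'" and q: "1 \<le> q" "q \<le> m_pts p w J' t a - 1"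
    and s: "cpt p w J' t a q \<le> s" "s < cpt p w J' t a (Suc q)"
  shows "Jl p w J' t a q = preceding J' t a s"
    and "Jr p w J' t a q = J' - {a} - preceding J' t a s"
proof -
  let ?m = "m_pts p w J' t a" and ?c = "cpt p w J' t a"
  have fin: "finite J'" using sub finite_J finite_subset by blast
  have qm: "q < ?m" using q by linarith
  have c_le: "c_aj p w a j \<le> ?c q" if jN: "j \<in> crossing J' t a" and le: "c_aj p w a j \<le> s" for j
  proof -
    have "?c (Suc q) \<le> t_end p J' t"
      using Cset_bounds(2)[OF sub cpt_in_Cset[OF fin]] qm by simp
    then have "c_aj p w a j < t_end p J' t" using le s by simp
    moreover have "t < c_aj p w a j"
      using jN sub p_pos[of j] by (auto simp: crossing_def c_aj_def)
    ultimately have "c_aj p w a j \<in> Cset p w J' t a"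
      using jN by (auto simp: Cset_def crossing_def)
    then obtain r where r: "1 \<le> r" "r \<le> ?m" "?c r = c_aj p w a j" using Cset_cptE[OF fin] by metis
    then have "?c r < ?c (Suc q)" using le s by simp
    then have "r < Suc q" using r qm by (subst (asm) cpt_less_iff) auto
    then have "\<not> ?c q < ?c r" using r q qm by (subst cpt_less_iff) auto
    then show ?thesis using r by simp
  qed
  have iff: "Mlab p w J' t a j \<le> q \<longleftrightarrow> j \<in> preceding J' t a s" if "j \<in> J' - {a}" for j
    using Mlab_le_iff[OF sub a that q] c_le s(1) by (auto simp: preceding_def)
  have "preceding J' t a s \<subseteq> J' - {a}" by (auto simp: preceding_def crossing_def)
  then show "Jl p w J' t a q = preceding J' t a s" using iff by (auto simp: Jl_def)
  \<comment> \<open>Label 1 keeps \<open>a\<close> out of \<open>Jr\<close> for every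
    \<open>q \<ge> 1\<close>.\<close>
  have "Mlab p w J' t a a \<le> q" using q by (simp add: Mlab_def)
  then show "Jr p w J' t a q = J' - {a} - preceding J' t a s"
    using iff unfolding Jr_def by (auto simp: not_le[symmetric])
qed

lemma feasible_qD:
  assumes sub: "J' \<subseteq> J" and a: "a \<in> J'" and q: "q \<in> feasible_q J p w J' t a"
  defines "s \<equiv> s_q p w J' t a q"
  shows "t \<le> s" "s < t_end p J' t" "s \<notin> banned J p w a"
    "Jl p w J' t a q = preceding J' t a s"
    "Jr p w J' t a q = J' - {a} - preceding J' t a s"
proof -
  have fin: "finite J'" using sub finite_J finite_subset by blast
  have q': "1 \<le> q" "q \<le> m_pts p w J' t a - 1" "cpt p w J' t a q \<le> s" "s < cpt p w J' t a (Suc q)"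
    using q by (auto simp: feasible_q_def s_def)
  show "s \<notin> banned J p w a" using q by (auto simp: feasible_q_def s_def)
  show "Jl p w J' t a q = preceding J' t a s" "Jr p w J' t a q = J' - {a} - preceding J' t a s"
    using Jl_Jr_eq[OF sub a q'] by auto
  have "t \<le> cpt p w J' t a q"
    using Cset_bounds(1)[OF sub cpt_in_Cset[OF fin q'(1)]] q' by simp
  then show "t \<le> s" using q' by simp
  have "cpt p w J' t a (Suc q) \<le> t_end p J' t"
    using Cset_bounds(2)[OF sub cpt_in_Cset[OF fin]] q' by simp
  then show "s < t_end p J' t" using q' by simp
qed

text \<open>Candidates correspond to solutions of the fixed-point equation for the start time of
  \<open>a\<close>. The index is the largest one whose point is at most \<open>s\<close>;
  \<open>s < t_end p J' t\<close> ensures that it has a successor.\<close>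

lemma feasible_qI:
  assumes sub: "J' \<subseteq> J" and a: "a \<in> J'"
    and s: "s = t + sum p (preceding J' t a s)" "t \<le> s" "s < t_end p J' t" "s \<notin> banned J p w a"
  shows "\<exists>q\<in>feasible_q J p w J' t a. s_q p w J' t a q = s"
proof -
  let ?m = "m_pts p w J' t a" and ?c = "cpt p w J' t a"
  have fin: "finite J'" using sub finite_J finite_subset by blast
  define R where "R = {r. 1 \<le> r \<and> r \<le> ?m \<and> ?c r \<le> s}"
  have finR: "finite R" by (simp add: R_def)
  have "t \<in> Cset p w J' t a" by (simp add: Cset_def)
  then obtain r0 where r0: "1 \<le> r0" "r0 \<le> ?m" "?c r0 = t" using Cset_cptE[OF fin] by metis
  then have "R \<noteq> {}" using s by (auto simp: R_def)
  define q where "q = Max R"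
  have q: "q \<in> R" using finR \<open>R \<noteq> {}\<close> by (simp add: q_def)
  have "t_end p J' t \<in> Cset p w J' t a" by (simp add: Cset_def)
  then obtain r1 where r1: "1 \<le> r1" "r1 \<le> ?m" "?c r1 = t_end p J' t" using Cset_cptE[OF fin] by metis
  then have "?c q < ?c r1" using q s by (simp add: R_def)
  then have "q < r1" using r1 q by (subst (asm) cpt_less_iff) (auto simp: R_def)
  then have qm: "q < ?m" using r1 by simp
  have "Suc q \<notin> R" using Max_ge[OF finR, of "Suc q"] unfolding q_def by force
  then have c: "1 \<le> q" "q \<le> ?m - 1" "?c q \<le> s" "s < ?c (Suc q)"
    using q qm by (auto simp: R_def)
  have "s_q p w J' t a q = s"
    using Jl_Jr_eq(1)[OF sub a c] s(1) by (simp add: s_q_def)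
  then show ?thesis using c s(4) by (intro bexI[of _ q]) (auto simp: feasible_q_def)
qed

section \<open>Banned sets along the recursion\<close>

text \<open>The banned sets refer to all of \<open>J\<close>. This invariant of the recursion says that, for a job of the
  subproblem, the intervals caused by jobs outside the subproblem miss its time window.\<close>
definition separated :: "'a set \<Rightarrow> real \<Rightarrow> bool" where
  "separated J' t \<longleftrightarrow> J' \<subseteq> J \<and> 0 \<le> t \<and> t_end p J' t \<le> sum p J \<and>
    (\<forall>i\<in>J'. \<forall>k\<in>J - J'. phi p w k 0 < phi p w i 0 \<longrightarrow> tstar_defined p w i k \<longrightarrow> 0 < tstar p w i k \<longrightarrow>
        t_end p J' t \<le> tstar p w i k \<or> tstar p w i k + p k \<le> t)"

text \<open>If \<open>k\<close> crosses but does not precede \<open>a\<close>, then \<open>s\<close>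
  lies before \<open>c_aj p w a k\<close>. The interval from the root to that point is banned
  because \<open>a\<close> strictly dominates \<open>k\<close> at time 0, so \<open>s\<close> lies
  before the root, where \<open>a\<close> still dominates.\<close>

lemma not_preceding_phi_le:
  assumes sep: "separated J' t" and a: "is_alpha p w J' t a"
    and s: "s < t_end p J' t" "s \<notin> banned J p w a"
    and k: "k \<in> J' - {a} - preceding J' t a s" and y: "t \<le> y" "y \<le> s"
  shows "phi p w k y \<le> phi p w a y"
proof (cases "k \<in> crossing J' t a")
  case True
  have sub: "J' \<subseteq> J" and t: "0 \<le> t" and T: "t_end p J' t \<le> sum p J"
    using sep by (auto simp: separated_def)
  have ts: "tstar_defined p w a k" "t < tstar p w a k" "tstar p w a k < t_end p J' t"
    using True by (auto simp: crossing_def)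
  have "\<not> phi p w a 0 \<le> phi p w k 0"
    using crossing_phi_le_iff(2)[OF a sub t True, of 0] ts t by simp
  then have "{tstar p w a k ..< tstar p w a k + p k} \<subseteq> banned J p w a"
    using k sub ts t T unfolding banned_def by force
  moreover have "s < tstar p w a k + p k"
    using k True by (auto simp: preceding_def c_aj_def)
  ultimately have "s < tstar p w a k" using s(2) by (auto simp: not_less[symmetric])
  then show ?thesis using crossing_phi_le_iff(1)[OF a sub t True, of y] y t by simp
next
  case False
  then show ?thesis
    using noncrossing_phi_le[OF a _ _ _ False] sep k y s by (auto simp: separated_def)
qed

text \<open>The new window ends at \<open>s\<close>. Jobs outside \<open>J'\<close> are handled by
  the parent invariant. For \<open>k = a\<close> the root would be at most \<open>t\<close>, which
  is impossible for a crossing job. A job \<open>k\<close> sent to the right satisfies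
  \<open>phi k \<le> phi a \<le> phi i\<close> at \<open>s\<close>, so its root with
  \<open>i\<close> is at least \<open>s\<close>.\<close>

lemma separated_Jl:
  assumes sep: "separated J' t" and a: "is_alpha p w J' t a" and q: "q \<in> feasible_q J p w J' t a"
  shows "separated (Jl p w J' t a q) t"
proof -
  define s where "s = s_q p w J' t a q"
  define P where "P = preceding J' t a s"
  have sub: "J' \<subseteq> J" and t: "0 \<le> t" and T: "t_end p J' t \<le> sum p J"
    using sep by (auto simp: separated_def)
  have aJ': "a \<in> J'" using a by (simp add: is_alpha_def)
  note fq = feasible_qD[OF sub aJ' q, folded s_def]
  have Jl: "Jl p w J' t a q = P" using fq by (simp add: P_def)
  have te: "t_end p P t = s" using Jl by (simp add: t_end_def s_def s_q_def)
  have PJ': "P \<subseteq> J' - {a}" by (auto simp: P_def preceding_def crossing_def)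
  have "s \<le> tstar p w i k \<or> tstar p w i k + p k \<le> t"
    if i: "i \<in> P" and k: "k \<in> J - P" and ph: "phi p w k 0 < phi p w i 0"
      and ts: "tstar_defined p w i k" "0 < tstar p w i k" for i k
  proof -
    have iJ: "i \<in> J" "i \<in> J'" and kJ: "k \<in> J" using i k PJ' sub by auto
    note iff = phi_le_iff_le_tstar[OF iJ(1) kJ ts(1) order.refl ts(2) less_imp_le[OF ph]]
    have iN: "i \<in> crossing J' t a" "tstar p w a i + p i \<le> s"
      using i by (auto simp: P_def preceding_def c_aj_def)
    consider "k \<notin> J'" | "k = a" | "k \<in> J' - {a} - P" using k by blast
    then show ?thesis
    proof cases
      case 1
      then have "t_end p J' t \<le> tstar p w i k \<or> tstar p w i k + p k \<le> t"
        using sep iJ kJ ph ts by (auto simp: separated_def)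
      then show ?thesis using fq by linarith
    next
      case 2
      have "phi p w i t \<le> phi p w a t" using a iJ by (auto simp: is_alpha_def)
      then have "tstar p w i a \<le> t" using iff(2)[OF t] 2 by simp
      then show ?thesis using iN(1) tstar_sym[of i a] by (auto simp: crossing_def)
    next
      case 3
      have "phi p w k s \<le> phi p w a s"
        using not_preceding_phi_le[OF sep a fq(2,3) _ fq(1) order.refl] 3 by (simp add: P_def)
      also have "\<dots> \<le> phi p w i s"
        using crossing_phi_le_iff(2)[OF a sub t iN(1), of s] iN(2) p_pos[OF iJ(1)] fq(1) t by simp
      finally show ?thesis using iff(1)[of s] fq(1) t by simp
    qed
  qed
  then show ?thesis unfolding separated_def Jl te using PJ' sub t T fq(2) by auto
qed

lemma Jl_Jr_partition:
  assumes "J' \<subseteq> J" "a \<in> J'" "q \<in> feasible_q J p w J' t a"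
  shows "J' = insert a (Jl p w J' t a q \<union> Jr p w J' t a q)"
    "Jl p w J' t a q \<inter> Jr p w J' t a q = {}" "a \<notin> Jl p w J' t a q" "a \<notin> Jr p w J' t a q"
  unfolding feasible_qD(4,5)[OF assms] using assms(2) by (auto simp: preceding_def crossing_def)

lemma t_end_Jr:
  assumes "J' \<subseteq> J" "a \<in> J'" "q \<in> feasible_q J p w J' t a"
  shows "t_end p (Jr p w J' t a q) (s_q p w J' t a q + p a) = t_end p J' t"
proof -
  note P = Jl_Jr_partition[OF assms]
  have fin: "finite (Jl p w J' t a q)" "finite (Jr p w J' t a q)"
    using P(1) assms(1) finite_J by (metis finite_insert finite_Un finite_subset)+
  have "sum p J' = sum p (insert a (Jl p w J' t a q \<union> Jr p w J' t a q))" using P(1) by simp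
  also have "\<dots> = p a + (sum p (Jl p w J' t a q) + sum p (Jr p w J' t a q))"
    using P(2-4) fin by (simp add: sum.union_disjoint)
  finally show ?thesis by (simp add: t_end_def s_q_def)
qed

text \<open>The new window starts at \<open>s + p a\<close>. The interval of \<open>a\<close> ends
  by \<open>t + p a\<close>. For \<open>k\<close> sent to the left, let \<open>x\<close> be its root
  with \<open>a\<close>: then \<open>phi i \<le> phi a \<le> phi k\<close> at \<open>x\<close>, so
  the root of \<open>i\<close> and \<open>k\<close> is at most \<open>x\<close>, and the interval
  ends by \<open>x + p k \<le> s\<close>.\<close>

lemma separated_Jr:
  assumes sep: "separated J' t" and a: "is_alpha p w J' t a" and q: "q \<in> feasible_q J p w J' t a"
  shows "separated (Jr p w J' t a q) (s_q p w J' t a q + p a)"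
proof -
  define s where "s = s_q p w J' t a q"
  define P where "P = preceding J' t a s"
  define R where "R = J' - {a} - P"
  have sub: "J' \<subseteq> J" and t: "0 \<le> t" and T: "t_end p J' t \<le> sum p J"
    using sep by (auto simp: separated_def)
  have aJ': "a \<in> J'" using a by (simp add: is_alpha_def)
  have pa: "0 < p a" using aJ' sub p_pos by auto
  note fq = feasible_qD[OF sub aJ' q, folded s_def]
  have Jr: "Jr p w J' t a q = R" using fq by (simp add: P_def R_def)
  have te: "t_end p R (s + p a) = t_end p J' t" using t_end_Jr[OF sub aJ' q] Jr by (simp add: s_def)
  have "t_end p J' t \<le> tstar p w i k \<or> tstar p w i k + p k \<le> s + p a"
    if i: "i \<in> R" and k: "k \<in> J - R" and ph: "phi p w k 0 < phi p w i 0"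
      and ts: "tstar_defined p w i k" "0 < tstar p w i k" for i k
  proof -
    have iJ: "i \<in> J" "i \<in> J'" and kJ: "k \<in> J" using i k sub by (auto simp: R_def)
    note iff = phi_le_iff_le_tstar[OF iJ(1) kJ ts(1) order.refl ts(2) less_imp_le[OF ph]]
    consider "k \<notin> J'" | "k = a" | "k \<in> P" using k by (auto simp: R_def)
    then show ?thesis
    proof cases
      case 1
      then have "t_end p J' t \<le> tstar p w i k \<or> tstar p w i k + p k \<le> t"
        using sep iJ kJ ph ts by (auto simp: separated_def)
      then show ?thesis using fq pa by linarith
    next
      case 2
      have "phi p w i t \<le> phi p w a t" using a iJ by (auto simp: is_alpha_def)
      then have "tstar p w i a \<le> t" using iff(2)[OF t] 2 by simp
      then show ?thesis using 2 fq(1) by simp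
    next
      case 3
      define x where "x = tstar p w a k"
      have kN: "k \<in> crossing J' t a" "x + p k \<le> s" "t < x"
        using 3 by (auto simp: P_def preceding_def c_aj_def x_def crossing_def)
      have "phi p w i x \<le> phi p w a x"
        using not_preceding_phi_le[OF sep a fq(2,3), of i x] i kN p_pos[OF kJ] by (simp add: P_def R_def)
      also have "\<dots> \<le> phi p w k x"
        using crossing_phi_le_iff(2)[OF a sub t kN(1), of x] kN t by (simp add: x_def)
      finally have "tstar p w i k \<le> x" using iff(2)[of x] kN t by simp
      then show ?thesis using kN pa by linarith
    qed
  qed
  then show ?thesis unfolding separated_def Jr s_def[symmetric] te
    using sub t T fq(1) pa by (auto simp: R_def)
qed

text \<open>The start of \<open>a\<close> in the structured optimum is not banned: intervals of jobs
  outside \<open>J'\<close> miss the window by \<open>separated\<close>, those of crossing jobs are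
  avoided by construction, and a non-crossing job that could ban has its root at or after the window
  end.\<close>

lemma feasible_optimum:
  assumes sep: "separated J' t" and a: "is_alpha p w J' t a"
  shows "\<exists>q\<in>feasible_q J p w J' t a. \<exists>l r. opt p w J' t (l @ a # r)
    \<and> set l = Jl p w J' t a q \<and> set r = Jr p w J' t a q"
proof -
  have sub: "J' \<subseteq> J" and t: "0 \<le> t" and T: "t_end p J' t \<le> sum p J"
    using sep by (auto simp: separated_def)
  have aJ': "a \<in> J'" using a by (simp add: is_alpha_def)
  obtain l r where o: "opt p w J' t (l @ a # r)"
    and l: "set l = {j \<in> crossing J' t a. c_aj p w a j \<le> t + len p l}"
    and gap: "\<forall>j\<in>crossing J' t a. t + len p l \<notin> {tstar p w a j ..< c_aj p w a j}"
    using structured_optimum[OF a sub t] by blast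
  define s where "s = t + len p l"
  have sch: "distinct (l @ a # r)" "set (l @ a # r) = J'" using o by (auto simp: opt_def is_schedule_def)
  have lP: "set l = preceding J' t a s" using l by (simp add: preceding_def s_def)
  have "\<forall>x\<in>set (l @ a # r). 0 < p x" using sch sub p_pos by auto
  then have nn: "0 \<le> len p l" "0 \<le> len p r" "0 < p a"
    by (auto intro!: sum_list_nonneg simp: less_imp_le)
  have te: "t_end p J' t = s + p a + len p r"
    using len_eq_sum[OF sch(1), of p] sch(2) by (simp add: t_end_def s_def)
  have s: "t \<le> s" "s < t_end p J' t" using nn te by (auto simp: s_def)
  have nb: "s \<notin> banned J p w a"
  proof
    assume "s \<in> banned J p w a"
    then obtain j where j: "j \<in> J - {a}" "phi p w j 0 < phi p w a 0" "tstar_defined p w a j"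
      "0 < tstar p w a j" "tstar p w a j \<le> s" "s < tstar p w a j + p j"
      by (auto simp: banned_def)
    consider "j \<notin> J'" | "j \<in> crossing J' t a" | "j \<in> J'" "j \<notin> crossing J' t a" by blast
    then show False
    proof cases
      case 1
      then have "t_end p J' t \<le> tstar p w a j \<or> tstar p w a j + p j \<le> t"
        using sep aJ' j by (auto simp: separated_def)
      then show False using s j by linarith
    next
      case 2
      then show False using gap j by (auto simp: s_def c_aj_def)
    next
      case 3
      have "phi p w j (t_end p J' t) \<le> phi p w a (t_end p J' t)"
        using noncrossing_phi_le[OF a sub t 3] s by simp
      then have "t_end p J' t \<le> tstar p w a j"
        using phi_le_iff_le_tstar(1)[of a j 0 "t_end p J' t"] j aJ' sub s t by auto
      then show False using s j by linarith
    qed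
  qed
  have "s = t + sum p (preceding J' t a s)"
    using lP len_eq_sum[of l p] sch by (simp add: s_def)
  then obtain q where q: "q \<in> feasible_q J p w J' t a" "s_q p w J' t a q = s"
    using feasible_qI[OF sub aJ' _ s nb] by blast
  have "set r = J' - {a} - set l" using sch by auto
  then show ?thesis using feasible_qD(4,5)[OF sub aJ' q(1)] q o lP by metis
qed

section \<open>Optimality of the returned schedules and existence of a result\<close>

lemma fast_schedule_opt:
  assumes "fast_schedule J p w J' t v \<sigma>" "separated J' t"
  shows "opt p w J' t \<sigma> \<and> v = sval p w t \<sigma>"
  using assms
proof (induction rule: fast_schedule.induct)
  case (fs_empty t)
  then show ?case by (simp add: opt_def is_schedule_def)
next
  case (fs_single j t)
  then show ?case by (simp add: opt_def is_schedule_singleton_iff add.commute)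
next
  case (fs_step J' t a vl sl vr sr q0)
  let ?F = "feasible_q J p w J' t a" and ?Jl = "Jl p w J' t a" and ?Jr = "Jr p w J' t a"
    and ?s = "s_q p w J' t a"
  note sep = fs_step.prems and a = fs_step.hyps(3)
  have sub: "J' \<subseteq> J" using sep by (simp add: separated_def)
  have aJ': "a \<in> J'" using a by (simp add: is_alpha_def)
  have L: "opt p w (?Jl q) t (sl q)" "vl q = sval p w t (sl q)" if "q \<in> ?F" for q
    using fs_step.IH that separated_Jl[OF sep a that] by auto
  have R: "opt p w (?Jr q) (?s q + p a) (sr q)" "vr q = sval p w (?s q + p a) (sr q)" if "q \<in> ?F" for q
    using fs_step.IH that separated_Jr[OF sep a that] by auto
  have val: "sval p w t (l @ a # r) = sval p w t l + sval p w (?s q + p a) r + w a / (?s q + p a)"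
    if "distinct l" "set l = ?Jl q" for l r q
    using that len_eq_sum[of l p] by (simp add: sval_append s_q_def)
  have sl: "distinct (sl q)" "set (sl q) = ?Jl q" "distinct (sr q)" "set (sr q) = ?Jr q" if "q \<in> ?F" for q
    using L(1)[OF that] R(1)[OF that] by (auto simp: opt_def is_schedule_def)
  have v0: "vl q0 + vr q0 + w a / (?s q0 + p a) = sval p w t (sl q0 @ [a] @ sr q0)"
    using val[of "sl q0" q0] sl L R fs_step.hyps by simp
  have sched: "is_schedule J' (sl q0 @ [a] @ sr q0)"
    using sl[OF fs_step.hyps(4)] Jl_Jr_partition[OF sub aJ' fs_step.hyps(4)]
    by (auto simp: is_schedule_def)
  \<comment> \<open>This optimum is split as in candidate \<open>q\<close>, whose parts are solved
    optimally by induction. So candidate \<open>q\<close>, and with it the best candidate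
    \<open>q0\<close>, is at least as good.\<close>
  obtain q l r where q: "q \<in> ?F" and o: "opt p w J' t (l @ a # r)"
    and lr: "set l = ?Jl q" "set r = ?Jr q"
    using feasible_optimum[OF sep a] by blast
  have dist: "distinct l" "distinct r" using o by (auto simp: opt_def is_schedule_def)
  have "sval p w t l \<le> vl q" "sval p w (?s q + p a) r \<le> vr q"
    using L[OF q] R[OF q] lr dist by (auto simp: opt_def is_schedule_def)
  then have "sval p w t (l @ a # r) \<le> vl q + vr q + w a / (?s q + p a)"
    using val[OF dist(1) lr(1)] by simp
  also have "\<dots> \<le> sval p w t (sl q0 @ [a] @ sr q0)"
    using fs_step.hyps(5) q v0 by auto
  finally have "sval p w t (l @ a # r) \<le> sval p w t (sl q0 @ [a] @ sr q0)" .
  then show ?case using o sched v0 unfolding opt_def by (meson order_trans)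
qed

lemma is_alpha_exists:
  assumes "finite J'" "J' \<noteq> {}"
  shows "\<exists>a. is_alpha p w J' t a"
proof -
  obtain b where b: "b \<in> J'" "\<forall>i\<in>J'. phi p w i t \<le> phi p w b t"
    using finite_argmax[OF assms, of "\<lambda>i. phi p w i t"] by blast
  let ?S = "{i \<in> J'. phi p w i t = phi p w b t}"
  have "finite ?S" "?S \<noteq> {}" using assms b by auto
  from finite_argmax[OF this, of "\<lambda>i. phi p w i (t_end p J' t)"]
  obtain a where "a \<in> ?S" "\<forall>i\<in>?S. phi p w i (t_end p J' t) \<le> phi p w a (t_end p J' t)"
    by (elim bexE)
  then have "is_alpha p w J' t a" using b(2) unfolding is_alpha_def by simp
  then show ?thesis by blast
qed

text \<open>Since \<open>fast_schedule\<close> is a relation, \<open>fast_schedule_opt\<close> alone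
  could hold vacuously. Both parts lose \<open>a\<close>, which gives the induction on the number of
  jobs, and \<open>feasible_optimum\<close> supplies at least one candidate.\<close>

lemma fast_schedule_exists:
  assumes "separated J' t"
  shows "\<exists>v \<sigma>. fast_schedule J p w J' t v \<sigma>"
  using assms
proof (induction "card J'" arbitrary: J' t rule: less_induct)
  case less
  have sub: "J' \<subseteq> J" using less.prems by (simp add: separated_def)
  then have fin: "finite J'" using finite_J finite_subset by blast
  consider "J' = {}" | j where "J' = {j}" | "2 \<le> card J'"
    using fin by (metis One_nat_def Suc_leI card_0_eq card_1_singletonE le_neq_implies_less
        neq0_conv numeral_2_eq_2)
  then show ?case
  proof cases
    case 3
    then obtain a where a: "is_alpha p w J' t a" using is_alpha_exists[OF fin] by force
    then have aJ': "a \<in> J'" by (simp add: is_alpha_def)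
    let ?F = "feasible_q J p w J' t a" and ?s = "s_q p w J' t a"
    have smaller: "card (Jl p w J' t a q) < card J'" "card (Jr p w J' t a q) < card J'"
      if "q \<in> ?F" for q
      using Jl_Jr_partition[OF sub aJ' that] by (intro psubset_card_mono[OF fin]; blast)+
    have "\<forall>q\<in>?F. \<exists>x. fast_schedule J p w (Jl p w J' t a q) t (fst x) (snd x)"
      using less.hyps smaller(1) separated_Jl[OF less.prems a] by (metis fst_conv snd_conv)
    then obtain f where f: "\<forall>q\<in>?F. fast_schedule J p w (Jl p w J' t a q) t (fst (f q)) (snd (f q))"
      by metis
    have "\<forall>q\<in>?F. \<exists>x. fast_schedule J p w (Jr p w J' t a q) (?s q + p a) (fst x) (snd x)"
      using less.hyps smaller(2) separated_Jr[OF less.prems a] by (metis fst_conv snd_conv)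
    then obtain g where g: "\<forall>q\<in>?F. fast_schedule J p w (Jr p w J' t a q) (?s q + p a) (fst (g q)) (snd (g q))"
      by metis
    have "?F \<noteq> {}" using feasible_optimum[OF less.prems a] by blast
    moreover have "finite ?F" by (simp add: feasible_q_def)
    ultimately obtain q0 where "q0 \<in> ?F"
      "\<forall>q\<in>?F. fst (f q) + fst (g q) + w a / (?s q + p a) \<le> fst (f q0) + fst (g q0) + w a / (?s q0 + p a)"
      using finite_argmax[of ?F "\<lambda>q. fst (f q) + fst (g q) + w a / (?s q + p a)"] by blast
    with f g show ?thesis
      using fs_step[OF fin 3 a, of J "\<lambda>q. fst (f q)" "\<lambda>q. snd (f q)" "\<lambda>q. fst (g q)" "\<lambda>q. snd (g q)" q0]
      by blast
  next
    case 1
    then show ?thesis using fs_empty by blast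
  next
    case (2 j)
    then show ?thesis using fs_single[of J p w j t] by blast
  qed
qed

end

theorem theorem2:
  fixes J :: "'a set" and p w :: "'a \<Rightarrow> real"
  assumes "finite J"
    and "\<forall>j\<in>J. p j > 0"
    and "\<forall>j\<in>J. w j > 0"
  shows "(\<exists>v \<sigma>. fast_schedule J p w J 0 v \<sigma>)
    \<and> (\<forall>v \<sigma>. fast_schedule J p w J 0 v \<sigma> \<longrightarrow>
          is_schedule J \<sigma> \<and> v = sched_val p w \<sigma>
          \<and> (\<forall>\<tau>. is_schedule J \<tau> \<longrightarrow> sched_val p w \<tau> \<le> sched_val p w \<sigma>))"
proof -
  interpret jobs J p w using assms by unfold_locales auto
  \<comment> \<open>No job lies outside \<open>J\<close>, so the condition on outside jobs is
    vacuous.\<close>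
  have "separated J 0" by (simp add: separated_def t_end_def)
  then show ?thesis using fast_schedule_exists fast_schedule_opt
    unfolding sched_val_eq_sval opt_def by blast
qed

end
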